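(* Let $k\ge 2$, let $a_1,\dots,a_k$ be positive integers, let $F=K_{a_1,\dots,a_k}$, and suppose that a transversal design $\mathrm{TD}(k,a_i)$ exists for each $i=1,2,\dots,k$. Let $m=\prod_{i=1}^k a_i$. Then the complete multipartite graph $F^*=K_{ma_1,\dots,ma_k}$ admits an $F$-decomposition. Moreover, such a decomposition can be encoded with $m^2$ integer sequences of length $2k$ whose $i$-th and $(k+i)$-th terms vary between $1$ and $a_i$ (i.e., the copies of $F$ in the decomposition are in bijection with the set $([a_1]\times\cdots\times[a_k])^2$, where $[a]=\{1,\dots,a\}$).
   Context: $K_{a_1,\dots,a_k}$ denotes the complete $k$-partite graph with partite classes of sizes $a_1,\dots,a_k$. An $F$-decomposition of a graph $G$ is a collection of pairwise edge-disjoint subgraphs of $G$, each isomorphic to $F$, whose edge sets together cover $E(G)$. A transversal design $\mathrm{TD}(k,n)$ is a triple $(X,\mathcal G,\mathcal B)$ where $X$ is a set of $kn$ elements, $\mathcal G=(X_1,\dots,X_k)$ is a partition of $X$ into $k$ classes (groups) each of size $n$, $\mathcal B$ is a collection of $k$-element subsets of $X$ (blocks), and every unordered pair of elements of $X$ is contained either in exactly one group or in exactly one block, but not both. *)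

theory Defs
  imports "HOL-Library.Disjoint_Sets"
begin

record 'a ugraph =
  verts :: "'a set"
  edges :: "'a set set"

definition simple_graph :: "'a ugraph \<Rightarrow> bool" where
  "simple_graph G \<longleftrightarrow> (\<forall>e\<in>edges G. e \<subseteq> verts G \<and> card e = 2)"

definition subgraph_of :: "'a ugraph \<Rightarrow> 'a ugraph \<Rightarrow> bool" where
  "subgraph_of H G \<longleftrightarrow> simple_graph H \<and> verts H \<subseteq> verts G \<and> edges H \<subseteq> edges G"

definition isomorphic :: "'a ugraph \<Rightarrow> 'b ugraph \<Rightarrow> bool" where
  "isomorphic G H \<longleftrightarrow>
     (\<exists>f. bij_betw f (verts G) (verts H) \<and>
          (\<forall>x\<in>verts G. \<forall>y\<in>verts G. {x, y} \<in> edges G \<longleftrightarrow> {f x, f y} \<in> edges H))"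

definition decomposition :: "'b ugraph \<Rightarrow> 'a ugraph \<Rightarrow> 'a ugraph set \<Rightarrow> bool" where
  "decomposition F G D \<longleftrightarrow>
     (\<forall>H\<in>D. subgraph_of H G \<and> isomorphic H F) \<and>
     (\<forall>H\<in>D. \<forall>H'\<in>D. H \<noteq> H' \<longrightarrow> edges H \<inter> edges H' = {}) \<and>
     (\<Union>H\<in>D. edges H) = edges G"

text \<open>The vertex \<open>(i, x)\<close> is the \<open>x\<close>-th element of the \<open>i\<close>-th partite class, counting from \<open>0\<close>.\<close>

definition multipartite_verts :: "nat list \<Rightarrow> (nat \<times> nat) set" where
  "multipartite_verts a = {(i, x). i < length a \<and> x < a ! i}"

definition complete_multipartite :: "nat list \<Rightarrow> (nat \<times> nat) ugraph" where
  "complete_multipartite a =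
     \<lparr>verts = multipartite_verts a,
      edges = {{u, v} | u v. u \<in> multipartite_verts a \<and> v \<in> multipartite_verts a \<and> fst u \<noteq> fst v}\<rparr>"

text \<open>The groups are \<open>X 0, \<dots>, X (k - 1)\<close>. The last condition says that two distinct points lie either
  in exactly one group and in no block, or in no group and in exactly one block.\<close>

definition transversal_design ::
    "nat \<Rightarrow> nat \<Rightarrow> 'a set \<Rightarrow> (nat \<Rightarrow> 'a set) \<Rightarrow> 'a set set \<Rightarrow> bool" where
  "transversal_design k n P X B \<longleftrightarrow>
     finite P \<and> card P = k * n \<and>
     (\<Union>i<k. X i) = P \<and> disjoint_family_on X {..<k} \<and> (\<forall>i<k. card (X i) = n) \<and>
     (\<forall>b\<in>B. b \<subseteq> P \<and> card b = k) \<and>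
     (\<forall>x\<in>P. \<forall>y\<in>P. x \<noteq> y \<longrightarrow>
        ((\<exists>!i. i < k \<and> {x, y} \<subseteq> X i) \<and> \<not> (\<exists>b\<in>B. {x, y} \<subseteq> b)) \<or>
        (\<not> (\<exists>i<k. {x, y} \<subseteq> X i) \<and> (\<exists>!b. b \<in> B \<and> {x, y} \<subseteq> b)))"

text \<open>Point sets are finite, so taking the points to be natural numbers loses no generality.\<close>

definition TD_exists :: "nat \<Rightarrow> nat \<Rightarrow> bool" where
  "TD_exists k n \<longleftrightarrow> (\<exists>(P :: nat set) X B. transversal_design k n P X B)"

definition code_sequences :: "nat list \<Rightarrow> nat list set" where
  "code_sequences a =
     {s. length s = 2 * length a \<and>
         (\<forall>i<length a. s ! i \<in> {1..a ! i} \<and> s ! (length a + i) \<in> {1..a ! i})}"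

end

theory Submission
  imports Defs
begin

text \<open>A transversal design \<open>TD(k, n)\<close> is the same as an orthogonal array: a family of functions \<open>f i\<close> on
  the blocks, \<open>f i b\<close> being the point of \<open>b\<close> in group \<open>i\<close>, any two of which jointly map the blocks
  bijectively onto the pairs of points. Orthogonal arrays are closed under products, so there is one of
  order \<open>m\<close>, which decomposes \<open>K\<^bsub>m,\<dots>,m\<^esub>\<close> into \<open>m\<^sup>2\<close> copies of \<open>K\<^sub>k\<close>. Blowing up each vertex of class
  \<open>i\<close> into \<open>a i\<close> vertices turns this into a decomposition of \<open>F\<^sup>*\<close> into \<open>m\<^sup>2\<close> copies of \<open>F\<close>.\<close>

section \<open>Orthogonal arrays\<close>

text \<open>This is an array of strength 2 and index 1, equivalently \<open>k - 2\<close> mutually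
  orthogonal Latin squares when \<open>k \<ge> 2\<close>. Fixing the rows as
  \<open>{..<n * n}\<close> and the symbols as \<open>{..<n}\<close> leaves only \<open>k\<close>
  and \<open>n\<close> as parameters, so arrays of different origin can be combined.\<close>

definition orthogonal_array :: "nat \<Rightarrow> nat \<Rightarrow> bool" where
  "orthogonal_array k n \<longleftrightarrow>
     (\<exists>f :: nat \<Rightarrow> nat \<Rightarrow> nat. \<forall>i<k. \<forall>j<k. i \<noteq> j \<longrightarrow>
        bij_betw (\<lambda>b. (f i b, f j b)) {..<n * n} ({..<n} \<times> {..<n}))"

text \<open>Relabelling: columns 0 and 1 alone force \<open>B\<close> to have \<open>n * n\<close>
  elements, so rows and, column by column, symbols can be renumbered. Arrays over any types, such as
  products or blocks, thus qualify.\<close>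

lemma orthogonal_arrayI:
  fixes f :: "nat \<Rightarrow> 'b \<Rightarrow> 'c" and X :: "nat \<Rightarrow> 'c set"
  assumes k: "k \<ge> 2"
    and X: "\<And>i. i < k \<Longrightarrow> finite (X i) \<and> card (X i) = n"
    and bij: "\<And>i j. i < k \<Longrightarrow> j < k \<Longrightarrow> i \<noteq> j \<Longrightarrow> bij_betw (\<lambda>b. (f i b, f j b)) B (X i \<times> X j)"
  shows "orthogonal_array k n"
proof -
  have b01: "bij_betw (\<lambda>b. (f 0 b, f 1 b)) B (X 0 \<times> X 1)"
    using bij k by simp
  have "finite (X 0 \<times> X 1)" "card (X 0 \<times> X 1) = n * n"
    using X[of 0] X[of 1] k by (auto simp: card_cartesian_product)
  then have "finite B" "card B = n * n"
    using b01 bij_betw_finite bij_betw_same_card by metis+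
  then obtain h where h: "bij_betw h {..<n * n} B"
    using ex_bij_betw_nat_finite[of B] by (auto simp: atLeast0LessThan)
  have "\<exists>g. bij_betw g (X i) {..<n}" if "i < k" for i
    using X[OF that] ex_bij_betw_finite_nat[of "X i"] by (auto simp: atLeast0LessThan)
  then obtain g where g: "\<And>i. i < k \<Longrightarrow> bij_betw (g i) (X i) {..<n}"
    by metis
  have "bij_betw (\<lambda>b. (g i (f i (h b)), g j (f j (h b)))) {..<n * n} ({..<n} \<times> {..<n})"
    if ij: "i < k" "j < k" "i \<noteq> j" for i j
  proof -
    have "bij_betw (map_prod (g i) (g j)) (X i \<times> X j) ({..<n} \<times> {..<n})"
      using g ij by (intro bij_betw_map_prod) auto
    from bij_betw_trans[OF bij_betw_trans[OF h bij[OF ij]] this]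
    show ?thesis by (simp add: o_def)
  qed
  then show ?thesis
    unfolding orthogonal_array_def by (intro exI[of _ "\<lambda>i b. g i (f i (h b))"]) auto
qed

section \<open>Products of orthogonal arrays\<close>

lemma orthogonal_array_1:
  assumes "k \<ge> 2"
  shows "orthogonal_array k 1"
proof (rule orthogonal_arrayI[OF assms])
  show "finite {()} \<and> card {()} = 1"
    by simp
  show "bij_betw (\<lambda>b. ((), ())) {()} ({()} \<times> {()})"
    by (simp add: bij_betw_def)
qed

text \<open>Direct product construction: rows and symbols of the new array are pairs, and column
  \<open>i\<close> acts as \<open>f i\<close> on first components and as \<open>g i\<close> on
  second ones.\<close>

lemma orthogonal_array_mult:
  assumes k: "k \<ge> 2" and "orthogonal_array k n" "orthogonal_array k m"
  shows "orthogonal_array k (n * m)"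
proof -
  obtain f where f: "\<And>i j. i < k \<Longrightarrow> j < k \<Longrightarrow> i \<noteq> j \<Longrightarrow>
      bij_betw (\<lambda>b. (f i b, f j b)) {..<n * n} ({..<n} \<times> {..<n})"
    using assms(2) unfolding orthogonal_array_def by blast
  obtain g where g: "\<And>i j. i < k \<Longrightarrow> j < k \<Longrightarrow> i \<noteq> j \<Longrightarrow>
      bij_betw (\<lambda>b. (g i b, g j b)) {..<m * m} ({..<m} \<times> {..<m})"
    using assms(3) unfolding orthogonal_array_def by blast
  show ?thesis
  proof (rule orthogonal_arrayI[OF k])
    show "finite ({..<n} \<times> {..<m}) \<and> card ({..<n} \<times> {..<m}) = n * m"
      by (simp add: card_cartesian_product)
  next
    fix i j assume ij: "i < k" "j < k" "i \<noteq> j"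
    \<comment> \<open>The product map groups symbols by factor; this involution regroups them by
      column.\<close>
    let ?swap = "\<lambda>((x, y), (z, w)). ((x, z), (y, w))"
    have "bij_betw (map_prod (\<lambda>b. (f i b, f j b)) (\<lambda>b. (g i b, g j b)))
            ({..<n * n} \<times> {..<m * m}) (({..<n} \<times> {..<n}) \<times> ({..<m} \<times> {..<m}))"
      using f[OF ij] g[OF ij] by (rule bij_betw_map_prod)
    moreover have "bij_betw ?swap (({..<n} \<times> {..<n}) \<times> ({..<m} \<times> {..<m}))
            (({..<n} \<times> {..<m}) \<times> ({..<n} \<times> {..<m}))"
      by (rule bij_betw_byWitness[where f' = ?swap]) auto
    ultimately have "bij_betw (?swap \<circ> map_prod (\<lambda>b. (f i b, f j b)) (\<lambda>b. (g i b, g j b)))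
            ({..<n * n} \<times> {..<m * m}) (({..<n} \<times> {..<m}) \<times> ({..<n} \<times> {..<m}))"
      by (rule bij_betw_trans)
    then show "bij_betw (\<lambda>b. (map_prod (f i) (g i) b, map_prod (f j) (g j) b))
        ({..<n * n} \<times> {..<m * m}) (({..<n} \<times> {..<m}) \<times> ({..<n} \<times> {..<m}))"
      by (rule bij_betw_cong[THEN iffD1, rotated]) auto
  qed
qed

lemma orthogonal_array_prod:
  assumes "k \<ge> 2" "finite I" "\<And>i. i \<in> I \<Longrightarrow> orthogonal_array k (a i)"
  shows "orthogonal_array k (\<Prod>i\<in>I. a i)"
  using assms(2,3)
  by (induction I rule: finite_induct)
    (use orthogonal_array_1 orthogonal_array_mult assms(1) in auto)

section \<open>From transversal designs to orthogonal arrays\<close>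

lemma transversal_designD:
  assumes "transversal_design k n P X B"
  shows "finite P" "(\<Union>i<k. X i) = P" "disjoint_family_on X {..<k}"
    and "i < k \<Longrightarrow> card (X i) = n"
    and "b \<in> B \<Longrightarrow> b \<subseteq> P \<and> card b = k"
    and "x \<in> P \<Longrightarrow> y \<in> P \<Longrightarrow> x \<noteq> y \<Longrightarrow>
      (\<exists>!i. i < k \<and> {x, y} \<subseteq> X i) \<and> \<not> (\<exists>b\<in>B. {x, y} \<subseteq> b) \<or>
      \<not> (\<exists>i<k. {x, y} \<subseteq> X i) \<and> (\<exists>!b. b \<in> B \<and> {x, y} \<subseteq> b)"
  using assms unfolding transversal_design_def by simp_all

text \<open>Two points of one block never share a group, so mapping each point of \<open>b\<close>
  to the index of its group is injective. Since \<open>b\<close> has \<open>k\<close> points and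
  there are \<open>k\<close> indices, the map is also onto.\<close>

lemma transversal_design_meets_group:
  assumes T: "transversal_design k n P X B" and b: "b \<in> B" and i: "i < k"
  shows "\<exists>!x. x \<in> b \<inter> X i"
proof -
  note U = transversal_designD(2)[OF T]
  have bP: "b \<subseteq> P" and cb: "card b = k"
    using transversal_designD(5)[OF T b] by auto
  have uniq: "x = y" if "x \<in> b" "y \<in> b" "x \<in> X l" "y \<in> X l" "l < k" for x y l
  proof (rule ccontr)
    assume "x \<noteq> y"
    moreover have "x \<in> P" "y \<in> P"
      using that bP by auto
    ultimately have "\<not> (\<exists>b\<in>B. {x, y} \<subseteq> b) \<or> \<not> (\<exists>i<k. {x, y} \<subseteq> X i)"
      using transversal_designD(6)[OF T, of x y] by argo
    then show False
      using that b by auto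
  qed
  have "\<forall>x\<in>b. \<exists>l<k. x \<in> X l"
    using bP U by auto
  then obtain c where c: "\<And>x. x \<in> b \<Longrightarrow> c x < k \<and> x \<in> X (c x)"
    by metis
  have inj: "inj_on c b"
    using c uniq by (auto intro!: inj_onI) metis
  have "c ` b = {..<k}"
    using c cb card_image[OF inj] by (intro card_subset_eq) auto
  with i obtain x where "x \<in> b" "c x = i"
    by (metis imageE lessThan_iff)
  then show ?thesis
    using c uniq i by blast
qed

text \<open>Rows are blocks, and \<open>f i b\<close> is the point where \<open>b\<close> meets
  group \<open>i\<close>. Points of two different groups lie in exactly one common block: uniqueness
  makes a pair of columns injective, existence makes it surjective.\<close>

lemma orthogonal_array_if_TD:
  assumes k: "k \<ge> 2" and n: "n > 0" and TD: "TD_exists k n"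
  shows "orthogonal_array k n"
proof -
  obtain P :: "nat set" and X B where T: "transversal_design k n P X B"
    using TD unfolding TD_exists_def by blast
  define f where "f = (\<lambda>i b. THE x. x \<in> b \<inter> X i)"
  have f: "f i b \<in> b \<and> f i b \<in> X i" if "b \<in> B" "i < k" for i b
    using theI'[OF transversal_design_meets_group[OF T that]] by (simp add: f_def)
  have f_eq: "f i b = x" if "b \<in> B" "i < k" "x \<in> b" "x \<in> X i" for i b x
    unfolding f_def using that
    by (intro the1_equality[OF transversal_design_meets_group[OF T that(1,2)]]) auto
  have block: "\<exists>!b. b \<in> B \<and> {x, y} \<subseteq> b"
    if "i < k" "j < k" "i \<noteq> j" "x \<in> X i" "y \<in> X j" for i j x y
  proof -
    have disj: "l = l'" if "l < k" "l' < k" "z \<in> X l" "z \<in> X l'" for l l' z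
      using transversal_designD(3)[OF T] that unfolding disjoint_family_on_def by blast
    have "x \<in> P" "y \<in> P"
      using transversal_designD(2)[OF T] that by auto
    moreover have "\<not> (\<exists>l<k. {x, y} \<subseteq> X l)"
    proof
      assume "\<exists>l<k. {x, y} \<subseteq> X l"
      then obtain l where "l < k" "x \<in> X l" "y \<in> X l"
        by auto
      with disj[of i l x] disj[of j l y] that show False
        by simp
    qed
    moreover have "x \<noteq> y"
      using disj[of i j x] that by auto
    \<comment> \<open>The first alternative of the pair axiom puts both points in one group, which
      has just been excluded; the second is the claim.\<close>
    ultimately show ?thesis
      using transversal_designD(6)[OF T, of x y]
        ex1_implies_ex[of "\<lambda>l. l < k \<and> {x, y} \<subseteq> X l"] by argo
  qed
  show ?thesis
  proof (rule orthogonal_arrayI[OF k])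
    fix i assume "i < k"
    then have "card (X i) = n"
      by (rule transversal_designD(4)[OF T])
    \<comment> \<open>Infinite sets have \<open>card\<close> 0, so a positive cardinality gives
      finiteness.\<close>
    then show "finite (X i) \<and> card (X i) = n"
      using n by (auto intro: card_ge_0_finite)
  next
    fix i j assume ij: "i < k" "j < k" "i \<noteq> j"
    show "bij_betw (\<lambda>b. (f i b, f j b)) B (X i \<times> X j)"
      unfolding bij_betw_def
    proof
      show "inj_on (\<lambda>b. (f i b, f j b)) B"
      proof (rule inj_onI)
        fix b c assume bc: "b \<in> B" "c \<in> B" "(f i b, f j b) = (f i c, f j c)"
        have fb: "f i b \<in> b" "f j b \<in> b" "f i b \<in> X i" "f j b \<in> X j" "f i c \<in> c" "f j c \<in> c"
          using f[OF bc(1)] f[OF bc(2)] ij(1,2) by blast+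
        have "\<exists>!d. d \<in> B \<and> {f i b, f j b} \<subseteq> d"
          using ij fb(3,4) by (rule block)
        moreover have "{f i b, f j b} \<subseteq> b" "{f i b, f j b} \<subseteq> c"
          using fb bc(3) by simp_all
        ultimately show "b = c"
          using bc(1,2) by blast
      qed
      show "(\<lambda>b. (f i b, f j b)) ` B = X i \<times> X j"
      proof
        show "(\<lambda>b. (f i b, f j b)) ` B \<subseteq> X i \<times> X j"
          using f ij by auto
        show "X i \<times> X j \<subseteq> (\<lambda>b. (f i b, f j b)) ` B"
        proof clarify
          fix x y assume xy: "x \<in> X i" "y \<in> X j"
          then obtain b where "b \<in> B" "x \<in> b" "y \<in> b"
            using ex1_implies_ex[OF block[OF ij]] by auto
          then show "(x, y) \<in> (\<lambda>b. (f i b, f j b)) ` B"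
            using f_eq ij xy by (intro image_eqI[of _ _ b]) auto
        qed
      qed
    qed
  qed
qed

section \<open>Blowing up an orthogonal array\<close>

text \<open>The copies of \<open>F\<close> occupy classes that need not start at 0, hence an
  arbitrary vertex set, with the first component naming the class.\<close>

definition multipartite_on :: "('a \<times> 'b) set \<Rightarrow> ('a \<times> 'b) ugraph" where
  "multipartite_on V =
     \<lparr>verts = V, edges = {{u, v} | u v. u \<in> V \<and> v \<in> V \<and> fst u \<noteq> fst v}\<rparr>"

lemma verts_multipartite_on [simp]: "verts (multipartite_on V) = V"
  by (simp add: multipartite_on_def)

lemma edge_multipartite_on [simp]:
  "{u, v} \<in> edges (multipartite_on V) \<longleftrightarrow> u \<in> V \<and> v \<in> V \<and> fst u \<noteq> fst v"
  by (cases u; cases v) (auto simp: multipartite_on_def doubleton_eq_iff)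

lemma edge_multipartite_onE:
  assumes "e \<in> edges (multipartite_on V)"
  obtains i z j w where "e = {(i, z), (j, w)}" "i \<noteq> j" "(i, z) \<in> V" "(j, w) \<in> V"
  using assms by (auto simp: multipartite_on_def)

lemma complete_multipartite_eq:
  "complete_multipartite a = multipartite_on (multipartite_verts a)"
  by (simp add: complete_multipartite_def multipartite_on_def)

lemma subgraph_multipartite_on:
  assumes "V \<subseteq> W"
  shows "subgraph_of (multipartite_on V) (multipartite_on W)"
  using assms unfolding subgraph_of_def simple_graph_def
  by (auto elim!: edge_multipartite_onE simp: card_insert_if)

text \<open>Adjacency depends only on first components, so a bijection preserving them preserves
  edges.\<close>

lemma isomorphic_multipartite_on:
  assumes "bij_betw h V W" "\<And>u. u \<in> V \<Longrightarrow> fst (h u) = fst u"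
  shows "isomorphic (multipartite_on V) (multipartite_on W)"
  unfolding isomorphic_def
  using assms bij_betwE[OF assms(1)] by (intro exI[of _ h]) auto

text \<open>Class \<open>i\<close> of the large graph splits into \<open>m\<close> intervals of
  length \<open>a ! i\<close>, numbered by \<open>z div a ! i\<close>. The copy \<open>V b\<close>
  takes interval \<open>f i b\<close> in each class. An edge between classes \<open>i\<close> and
  \<open>j\<close> fixes a pair of interval numbers, hence exactly one row \<open>b\<close>.\<close>

lemma decomposition_blow_up:
  fixes f :: "nat \<Rightarrow> nat \<Rightarrow> nat" and a :: "nat list"
  defines "V \<equiv> \<lambda>b. {(i, z). i < length a \<and> z div a ! i = f i b}"
  assumes k: "length a \<ge> 2" and pos: "\<forall>i<length a. a ! i > 0"
    and f: "\<And>i j. i < length a \<Longrightarrow> j < length a \<Longrightarrow> i \<noteq> j \<Longrightarrow>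
      bij_betw (\<lambda>b. (f i b, f j b)) {..<m * m} ({..<m} \<times> {..<m})"
  shows "decomposition (complete_multipartite a) (complete_multipartite (map (\<lambda>n. m * n) a))
           ((\<lambda>b. multipartite_on (V b)) ` {..<m * m})"
    and "inj_on (\<lambda>b. multipartite_on (V b)) {..<m * m}"
proof -
  let ?W = "multipartite_verts (map (\<lambda>n. m * n) a)"
  have W: "(i, z) \<in> ?W \<longleftrightarrow> i < length a \<and> z div a ! i < m" for i z
    using pos by (auto simp: multipartite_verts_def less_mult_imp_div_less div_less_iff_less_mult)
  \<comment> \<open>The array property bounds symbols only through pairs of columns, so a second
    column \<open>j\<close> is needed.\<close>
  have f_less: "f i b < m" if "i < length a" "b < m * m" for i b
  proof -
    obtain j where "j < length a" "i \<noteq> j"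
      using k by (intro that[of "if i = 0 then 1 else 0"]) (auto split: if_splits)
    from bij_betwE[OF f[OF that(1) this]] that show ?thesis by auto
  qed
  have VW: "V b \<subseteq> ?W" if "b < m * m" for b
    using f_less that by (auto simp: V_def W)
  have iso: "isomorphic (multipartite_on (V b)) (complete_multipartite a)" for b
    unfolding complete_multipartite_eq
  proof (rule isomorphic_multipartite_on)
    \<comment> \<open>The remainder is the position inside the interval; the inverse adds the start
      \<open>f i b * a ! i\<close>.\<close>
    show "bij_betw (\<lambda>(i, z). (i, z mod a ! i)) (V b) (multipartite_verts a)"
      by (rule bij_betw_byWitness[where f' = "\<lambda>(i, x). (i, f i b * a ! i + x)"])
        (use pos in \<open>auto simp: V_def multipartite_verts_def\<close>, metis div_mult_mod_eq)
  qed auto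
  \<comment> \<open>Concluding equality of rows, not just of graphs, serves both edge-disjointness
    and injectivity.\<close>
  have eq: "b = c" if bc: "b < m * m" "c < m * m"
    and e: "e \<in> edges (multipartite_on (V b))" "e \<in> edges (multipartite_on (V c))" for b c e
  proof -
    obtain i z j w where ij: "e = {(i, z), (j, w)}" "i \<noteq> j"
      using e(1) by (rule edge_multipartite_onE)
    with e have l: "i < length a" "j < length a" and "(f i b, f j b) = (f i c, f j c)"
      by (auto simp: V_def)
    then show ?thesis
      by (intro inj_onD[OF bij_betw_imp_inj_on[OF f[OF l ij(2)]]]) (use bc in auto)
  qed
  have cover: "\<exists>b<m * m. e \<in> edges (multipartite_on (V b))" if e: "e \<in> edges (multipartite_on ?W)" for e
  proof -
    obtain i z j w where ij: "e = {(i, z), (j, w)}" "i \<noteq> j" "(i, z) \<in> ?W" "(j, w) \<in> ?W"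
      using e by (rule edge_multipartite_onE)
    then have l: "i < length a" "j < length a" "(z div a ! i, w div a ! j) \<in> {..<m} \<times> {..<m}"
      by (auto simp: W)
    then obtain b where "b < m * m" "(z div a ! i, w div a ! j) = (f i b, f j b)"
      unfolding bij_betw_imp_surj_on[OF f[OF l(1,2) ij(2)], symmetric] by auto
    then show ?thesis
      using ij l by (intro exI[of _ b]) (auto simp: V_def)
  qed
  show "decomposition (complete_multipartite a) (complete_multipartite (map (\<lambda>n. m * n) a))
          ((\<lambda>b. multipartite_on (V b)) ` {..<m * m})"
    unfolding decomposition_def complete_multipartite_eq[of "map _ _"]
  proof (intro conjI ballI impI)
    show "(\<Union>H\<in>(\<lambda>b. multipartite_on (V b)) ` {..<m * m}. edges H) = edges (multipartite_on ?W)"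
      using cover subgraph_multipartite_on[OF VW] unfolding subgraph_of_def by fastforce
  qed (use subgraph_multipartite_on[OF VW] iso eq in blast)+
  show "inj_on (\<lambda>b. multipartite_on (V b)) {..<m * m}"
  proof (rule inj_onI)
    fix b c assume bc: "b \<in> {..<m * m}" "c \<in> {..<m * m}"
      and H: "multipartite_on (V b) = multipartite_on (V c)"
    have l: "0 < length a" "1 < length a"
      using k by auto
    \<comment> \<open>Every copy has an edge, here between the first vertices of its intervals in
      classes 0 and 1. Equal copies thus share an edge and \<open>eq\<close> applies.\<close>
    have "{(0, f 0 b * a ! 0), (1, f 1 b * a ! 1)} \<in> edges (multipartite_on (V b))"
      using l pos[rule_format, OF l(1)] pos[rule_format, OF l(2)] by (simp add: V_def)
    then show "b = c"
      using eq bc H by (metis lessThan_iff)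
  qed
qed

section \<open>Counting the code sequences\<close>

text \<open>Head and tail are chosen independently, so each bound contributes one factor.\<close>

lemma card_bounded_lists:
  "finite {s. list_all2 (\<lambda>x n. x \<in> {1..n}) s a} \<and>
   card {s. list_all2 (\<lambda>x n. x \<in> {1..n}) s a} = prod_list (a :: nat list)"
proof (induction a)
  case Nil
  have "{s :: nat list. s = []} = {[]}" by auto
  then show ?case by simp
next
  case (Cons n a)
  let ?L = "\<lambda>a. {s. list_all2 (\<lambda>x n. x \<in> {1..n}) s (a :: nat list)}"
  have "?L (n # a) = (\<lambda>(x, s). x # s) ` ({1..n} \<times> ?L a)"
    by (auto simp: list_all2_Cons2)
  moreover have "inj_on (\<lambda>(x, s). x # s) ({1..n} \<times> ?L a)"
    by (auto simp: inj_on_def)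
  ultimately show ?case
    using Cons.IH by (simp add: card_image card_cartesian_product)
qed

text \<open>Positions \<open>i\<close> and \<open>length a + i\<close> have the same bound, so the
  list of bounds is \<open>a\<close> repeated, which explains the square in the count.\<close>

lemma code_sequences_eq:
  "code_sequences a = {s. list_all2 (\<lambda>x n. x \<in> {1..n}) s (a @ a)}" (is "_ = ?R")
proof (intro set_eqI iffI)
  fix s assume s: "s \<in> code_sequences a"
  have "s ! i \<in> {1..(a @ a) ! i}" if "i < 2 * length a" for i
  proof (cases "i < length a")
    case True
    then show ?thesis using s by (simp add: code_sequences_def nth_append)
  next
    case False
    then obtain j where "i = length a + j"
      by (metis le_Suc_ex linorder_not_less)
    then show ?thesis
      using s that by (simp add: code_sequences_def nth_append)
  qed
  then show "s \<in> ?R"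
    using s by (auto simp: code_sequences_def list_all2_conv_all_nth)
next
  fix s assume "s \<in> ?R"
  then have len: "length s = 2 * length a"
    and s: "\<And>i. i < 2 * length a \<Longrightarrow> s ! i \<in> {1..(a @ a) ! i}"
    by (auto simp: list_all2_conv_all_nth)
  have "s ! i \<in> {1..a ! i} \<and> s ! (length a + i) \<in> {1..a ! i}" if "i < length a" for i
    using s[of i] s[of "length a + i"] that by (simp add: nth_append)
  then show "s \<in> code_sequences a"
    using len by (simp add: code_sequences_def)
qed

lemma card_code_sequences:
  "finite (code_sequences a)" "card (code_sequences a) = (\<Prod>i<length a. a ! i)\<^sup>2"
proof -
  have "prod_list a = (\<Prod>i<length a. a ! i)"
    by (simp add: prod.list_conv_set_nth atLeast0LessThan)
  then show "finite (code_sequences a)" "card (code_sequences a) = (\<Prod>i<length a. a ! i)\<^sup>2"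
    using card_bounded_lists[of "a @ a"]
    unfolding code_sequences_eq by (simp_all add: power2_eq_square)
qed

theorem theorem3:
  fixes k m :: nat and a :: "nat list"
  assumes "k \<ge> 2"
    and "length a = k"
    and "\<forall>i<k. a ! i > 0"
    and "\<forall>i<k. TD_exists k (a ! i)"
    and "m = (\<Prod>i<k. a ! i)"
  shows "\<exists>D. decomposition (complete_multipartite a)
                           (complete_multipartite (map (\<lambda>n. m * n) a)) D \<and>
             card D = m\<^sup>2 \<and>
             (\<exists>code. bij_betw code D (code_sequences a))"
proof -
  have "orthogonal_array k m"
    unfolding assms(5) using assms(1,3,4)
    by (intro orthogonal_array_prod) (auto intro: orthogonal_array_if_TD)
  then obtain f where f: "\<And>i j. i < length a \<Longrightarrow> j < length a \<Longrightarrow> i \<noteq> j \<Longrightarrow>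
      bij_betw (\<lambda>b. (f i b, f j b)) {..<m * m} ({..<m} \<times> {..<m})"
    unfolding orthogonal_array_def assms(2) by blast
  define D where "D = (\<lambda>b. multipartite_on {(i, z). i < length a \<and> z div a ! i = f i b}) ` {..<m * m}"
  have pos: "\<forall>i<length a. a ! i > 0" and k: "length a \<ge> 2"
    using assms(1,2,3) by auto
  have "card D = m\<^sup>2"
    unfolding D_def using decomposition_blow_up(2)[OF k pos f]
    by (simp add: card_image power2_eq_square)
  \<comment> \<open>Both sets are finite with \<open>m\<^sup>2\<close> elements, which is enough for
    a bijection.\<close>
  moreover have "\<exists>code. bij_betw code D (code_sequences a)"
    using calculation card_code_sequences[of a] assms(2,5)
    by (intro finite_same_card_bij) (auto simp: D_def)
  moreover have "decomposition (complete_multipartite a) (complete_multipartite (map (\<lambda>n. m * n) a)) D"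
    unfolding D_def using decomposition_blow_up(1)[OF k pos f] .
  ultimately show ?thesis by blast
qed

end
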